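(* For every integer $m\ge 0$ and every $z$ with $0<|z|<1$, $$g_m(z) = \frac{1}{\sqrt{z}} \sum_{j=0}^m (-1)^j S(m+1,m+1-j)\int_0^\infty x^{(m-j)/2}K_{j+1-m}(2\sqrt{x})\sinh (2\sqrt{xz})\, dx.$$
   Context: $C_n=\frac{1}{n+1}\binom{2n}{n}$ ($n\ge 0$) denotes the $n$-th Catalan number. For each integer $m\ge 0$ and $|z|<1$, $$g_m(z)=\sum_{n=0}^\infty \frac{2^{2n}n^m}{2n+1}\frac{z^n}{C_n},$$ with the convention $0^0=1$. $S(n,k)$ are the Stirling numbers of the second kind: $S(0,0)=1$, $S(n,n)=S(n,1)=1$ for $n\ge1$, and $S(n,k)=\frac{1}{k!}\sum_{s=0}^k(-1)^s\binom{k}{s}(k-s)^n$. $K_v$ is the modified Bessel function of the second kind, $$K_v(x)=\int_0^\infty \cosh(vt)\,e^{-x\cosh t}\,dt\qquad (x>0).$$ Here $\sqrt{xz}=\sqrt{x}\sqrt{z}$ with the same choice of $\sqrt z$ as in the prefactor (the right-hand side does not depend on this choice). *)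

theory Defs
  imports "HOL-Analysis.Analysis" "HOL-Combinatorics.Stirling"
begin

definition catalan :: "nat \<Rightarrow> real" where
  "catalan n = real ((2 * n) choose n) / real (n + 1)"

text \<open>For \<open>m = n = 0\<close> the factor \<open>of_nat n ^ m\<close> is \<open>1\<close>.\<close>

definition g_term :: "nat \<Rightarrow> complex \<Rightarrow> nat \<Rightarrow> complex" where
  "g_term m z n =
     2 ^ (2 * n) * of_nat n ^ m / (2 * of_nat n + 1) * (z ^ n / of_real (catalan n))"

definition g :: "nat \<Rightarrow> complex \<Rightarrow> complex" where
  "g m z = (\<Sum>n. g_term m z n)"

text \<open>Modified Bessel function of the second kind, of real order \<open>v\<close>; meaningful only for
  \<open>x > 0\<close>, where the integral converges absolutely.\<close>

definition bessel_K :: "real \<Rightarrow> real \<Rightarrow> real" where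
  "bessel_K v x = (LBINT t:{0..}. cosh (v * t) * exp (- (x * cosh t)))"

end

theory Submission
  imports Defs "HOL-Real_Asymp.Real_Asymp"
begin

text \<open>
  Both sides are power series in \<open>z\<close> with the same coefficients. Expanding
  \<open>sinh (2 * sqrt x * w) / w\<close> in powers of \<open>z = w ^ 2\<close> shows that it suffices to know the
  integrals over \<open>x > 0\<close> of powers of \<open>x\<close> times \<open>bessel_K v (2 * sqrt x)\<close>. These are products of
  two Gamma values (\<open>nn_integral_bessel_K_moment\<close>), as follows by Tonelli from the representation
  \[ x^{v/2} K_v(2 \sqrt{x}) = \frac{1}{2} \int_0^\infty u^{v-1} e^{-u-x/u} \, du \]
  (\<open>bessel_K_eq_half_line_integral\<close>). For the \<open>j\<close>-th integral of the theorem, divided by \<open>w\<close>, the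
  coefficient of \<open>z ^ k\<close> comes out as \<open>4 ^ k * (k + 1)! * (m - j + k)! / (2 * k + 1)!\<close>
  (\<open>bessel_K_sinh_integral\<close>); the ratio test justifies the exchange of sum and integral for
  \<open>cmod z < 1\<close>.

  On the other side, writing the Catalan number by factorials, the coefficient of \<open>z ^ k\<close> in
  \<open>g m z\<close> is \<open>4 ^ k * (k + 1)! * k! / (2 * k + 1)! * k ^ m\<close>. What remains is the identity
  \[ \sum_{j=0}^m (-1)^j S(m+1,m+1-j) \frac{(m-j+k)!}{k!} = k^m , \]
  which expresses a power through rising factorials (\<open>sum_Stirling_pochhammer\<close>).
\<close>

section \<open>An integral over the half-line for the Bessel function\<close>

lemma power_div_fact_le_exp:
  fixes y :: real
  assumes "0 \<le> y"
  shows "y ^ n / fact n \<le> exp y"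
proof -
  have s: "(\<lambda>k. y ^ k / fact k) sums exp y"
    using exp_converges[of y] by (simp add: divide_inverse mult.commute)
  have "(\<Sum>k\<in>{n}. y ^ k / fact k) \<le> (\<Sum>k. y ^ k / fact k)"
    using assms s by (intro sum_le_suminf) (auto simp: sums_iff)
  then show ?thesis using s by (simp add: sums_iff)
qed

text \<open>
  For \<open>v \<le> 0\<close> the factor \<open>u powr (v - 1)\<close> alone is not integrable at \<open>0\<close>, but \<open>exp (- x / u)\<close>
  vanishes there faster than any power of \<open>u\<close>. Trading it for \<open>u ^ N\<close> with \<open>N > - v\<close> leaves the
  convergent Gamma integral at \<open>v + N\<close>.
\<close>
lemma integrable_bessel_kernel:
  fixes v x :: real
  assumes "0 < x"
  shows "set_integrable lborel {0<..} (\<lambda>u. u powr (v - 1) * exp (- (u + x / u)))"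
proof -
  obtain N :: nat where N: "- v < real N" using reals_Archimedean2 by blast
  define s where "s = v + real N"
  have s: "0 < s" using N by (simp add: s_def)
  have G: "integrable lborel (\<lambda>t. indicator {0..} t * t powr (s - 1) / exp t)"
    by (rule integrableI_nonneg)
       (auto simp flip: Gamma_conv_nn_integral_real[OF s] intro!: AE_I2)
  have "integrable lborel (\<lambda>t. fact N / x ^ N * (indicator {0..} t * t powr (s - 1) / exp t))"
    using G by (rule integrable_mult_right)
  then show ?thesis unfolding set_integrable_def
  proof (rule Bochner_Integration.integrable_bound)
    show "AE u in lborel. norm (indicat_real {0<..} u *\<^sub>R (u powr (v - 1) * exp (- (u + x / u))))
      \<le> norm (fact N / x ^ N * (indicat_real {0..} u * u powr (s - 1) / exp u))"
    proof (rule AE_I2)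
      fix u :: real
      show "norm (indicat_real {0<..} u *\<^sub>R (u powr (v - 1) * exp (- (u + x / u))))
        \<le> norm (fact N / x ^ N * (indicat_real {0..} u * u powr (s - 1) / exp u))"
      proof (cases "0 < u")
        case True
        have "(x / u) ^ N / fact N \<le> exp (x / u)"
          using True assms by (intro power_div_fact_le_exp) auto
        then have *: "exp (- (x / u)) \<le> fact N / x ^ N * u ^ N"
          using True assms by (simp add: exp_minus field_simps power_divide)
        have "u powr (v - 1) * exp (- (u + x / u)) = u powr (v - 1) / exp u * exp (- (x / u))"
          by (simp add: exp_diff exp_minus exp_add field_simps)
        also have "\<dots> \<le> u powr (v - 1) / exp u * (fact N / x ^ N * u ^ N)"
          by (intro mult_left_mono *) auto
        also have "\<dots> = fact N / x ^ N * (u powr (s - 1) / exp u)"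
          using True by (simp add: s_def powr_add powr_diff powr_realpow mult_ac)
        finally show ?thesis using True assms by simp
      qed auto
    qed
  qed measurable
qed

lemma bessel_K_minus: "bessel_K (- v) x = bessel_K v x"
  by (simp add: bessel_K_def)

text \<open>
  Evenness of \<open>cosh\<close> turns \<open>2 * bessel_K v (2 * sqrt x)\<close> into the integral of
  \<open>exp (v * t - 2 * sqrt x * cosh t)\<close> over the whole line. The substitution \<open>u = sqrt x * exp t\<close>
  then makes the exponent \<open>- (u + x / u)\<close>, so that \<open>x\<close> enters only through \<open>exp (- x / u)\<close> and can
  be integrated against a power of \<open>x\<close> by means of the Gamma function.
\<close>
lemma bessel_K_eq_half_line_integral:
  fixes v x :: real
  assumes x: "0 < x"
  shows "x powr (v / 2) * bessel_K v (2 * sqrt x)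
    = 1 / 2 * (LBINT u:{0<..}. u powr (v - 1) * exp (- (u + x / u)))"
proof -
  define f where "f u = u powr (v - 1) * exp (- (u + x / u))" for u
  define h where "h t = exp (v * t) * exp (- (2 * sqrt x * cosh t))" for t
  have [measurable]: "f \<in> borel_measurable borel" 
    unfolding f_def by measurable
  have "continuous_on UNIV h"
    unfolding h_def cosh_def by (intro continuous_intros)
  then have [measurable]: "h \<in> borel_measurable borel"
    by (rule borel_measurable_continuous_onI)
  have img: "range (\<lambda>t. sqrt x * exp t) = {0<..}"
  proof (intro equalityI subsetI)
    fix u :: real assume u: "u \<in> {0<..}"
    then have "u = sqrt x * exp (ln (u / sqrt x))" using x by simp
    then show "u \<in> range (\<lambda>t. sqrt x * exp t)" by blast
  qed (use x in auto)
  have fh: "\<bar>sqrt x * exp t\<bar> * f (sqrt x * exp t) = x powr (v / 2) * h t" for t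
  proof -
    have "sqrt x * exp t * (sqrt x * exp t) powr (v - 1) = (sqrt x * exp t) powr v"
      using x by (simp add: powr_diff)
    also have "\<dots> = x powr (v / 2) * exp (v * t)"
      using x by (simp add: powr_mult powr_half_sqrt[symmetric] powr_powr exp_powr_real mult.commute)
    finally have 1: "sqrt x * exp t * (sqrt x * exp t) powr (v - 1) = x powr (v / 2) * exp (v * t)" .
    have "x / (sqrt x * exp t) = sqrt x * exp (- t)"
      using x by (simp add: exp_minus field_simps)
    then have "sqrt x * exp t + x / (sqrt x * exp t) = 2 * sqrt x * cosh t"
      by (simp add: cosh_def algebra_simps)
    then show ?thesis using 1 x by (simp add: f_def h_def abs_mult)
  qed
  have fint: "set_integrable lborel {0<..} f"
    unfolding f_def by (rule integrable_bessel_kernel[OF x])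
  then have fint': "f absolutely_integrable_on {0<..}"
    unfolding set_integrable_def by (subst integrable_completion) auto
  have deriv: "((\<lambda>t. sqrt x * exp t) has_field_derivative sqrt x * exp t) (at t)" for t
    by (auto intro!: derivative_eq_intros)
  have "(\<lambda>t. \<bar>sqrt x * exp t\<bar> * f (sqrt x * exp t)) absolutely_integrable_on UNIV \<and>
           integral UNIV (\<lambda>t. \<bar>sqrt x * exp t\<bar> * f (sqrt x * exp t)) = integral {0<..} f"
    using has_absolute_integral_change_of_variables_1'
      [of UNIV "\<lambda>t. sqrt x * exp t" "\<lambda>t. sqrt x * exp t" f "integral {0<..} f"] x fint' deriv
    by (simp add: img inj_on_def)
  then have A: "(\<lambda>t. x powr (v / 2) * h t) absolutely_integrable_on UNIV"
    and B: "integral UNIV (\<lambda>t. x powr (v / 2) * h t) = integral {0<..} f"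
    unfolding fh by auto
  have hint0: "integrable lborel (\<lambda>t. x powr (v / 2) * h t)"
    using A unfolding set_integrable_def by (subst (asm) integrable_completion) auto
  then have hint: "integrable lborel h"
    using x by simp
  have "x powr (v / 2) * (LBINT t. h t) = (LBINT t. x powr (v / 2) * h t)"
    by simp
  also have "\<dots> = integral UNIV (\<lambda>t. x powr (v / 2) * h t)"
    by (rule integral_lborel[OF hint0, symmetric])
  also have "\<dots> = (LBINT u:{0<..}. f u)"
    unfolding B by (rule set_borel_integral_eq_integral(2)[OF fint, symmetric])
  finally have main: "x powr (v / 2) * (LBINT t. h t) = (LBINT u:{0<..}. f u)" .
  have sint: "set_integrable lborel S h" if "S \<in> sets borel" for S
    using hint that unfolding set_integrable_def
    by (intro integrable_mult_indicator) auto
  have hm: "integrable lborel (\<lambda>t. h (- t))"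
    using lborel_integrable_real_affine[OF hint, of "-1" 0] by simp
  have sm: "set_integrable lborel S (\<lambda>t. h (- t))" if "S \<in> sets borel" for S
    using hm that unfolding set_integrable_def
    by (intro integrable_mult_indicator) auto
  \<comment> \<open>Folding the line at \<open>0\<close> recovers the \<open>cosh\<close> in the definition of the Bessel function.\<close>
  have "(LBINT t. h t) = (LBINT t:{0..} \<union> {..<0}. h t)"
  proof -
    have "{0..} \<union> {..<0} = (UNIV :: real set)" by auto
    then show ?thesis by (simp add: set_lebesgue_integral_def)
  qed
  also have "\<dots> = (LBINT t:{0..}. h t) + (LBINT t:{..<0}. h t)"
    by (intro set_integral_Un sint) auto
  also have "(LBINT t:{..<0}. h t) = (LBINT t:{0<..}. h (- t))"
    by (subst set_integral_reflect) (simp add: greaterThan_def)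
  also have "\<dots> = (LBINT t:{0..}. h (- t))"
    unfolding set_lebesgue_integral_def
    by (intro integral_cong_AE)
       (auto intro!: eventually_mono[OF AE_lborel_singleton[of 0]] split: split_indicator)
  also have "(LBINT t:{0..}. h t) + (LBINT t:{0..}. h (- t)) = (LBINT t:{0..}. h t + h (- t))"
    by (intro set_integral_add(2)[symmetric] sint sm) auto
  also have "(\<lambda>t. h t + h (- t)) = (\<lambda>t. 2 * (cosh (v * t) * exp (- (2 * sqrt x * cosh t))))"
    by (simp add: h_def cosh_def fun_eq_iff field_simps)
  finally have "(LBINT t. h t) = 2 * bessel_K v (2 * sqrt x)"
    by (simp add: bessel_K_def)
  then show ?thesis using main by (simp add: f_def)
qed

lemma bessel_K_nonneg: "0 \<le> bessel_K v x"
  unfolding bessel_K_def set_lebesgue_integral_def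
  by (intro integral_nonneg_AE AE_I2) auto

lemma borel_measurable_bessel_K [measurable]: "bessel_K v \<in> borel_measurable borel"
proof -
  have [measurable]: "(cosh :: real \<Rightarrow> real) \<in> borel_measurable borel"
    unfolding cosh_def by measurable
  show ?thesis
    unfolding bessel_K_def set_lebesgue_integral_def by measurable
qed

section \<open>Moments of the Bessel function\<close>

lemma nn_integral_powr_exp:
  fixes a u :: real
  assumes "-1 < a" "0 < u"
  shows "(\<integral>\<^sup>+ x. ennreal (indicator {0<..} x * x powr a * exp (- (x / u))) \<partial>lborel)
    = ennreal (u powr (a + 1) * Gamma (a + 1))"
proof -
  have "(\<integral>\<^sup>+ x. ennreal (indicator {0<..} x * x powr a * exp (- (x / u))) \<partial>lborel)
    = ennreal u * (\<integral>\<^sup>+ y. ennreal (indicator {0<..} (0 + u * y) * (0 + u * y) powr a * exp (- ((0 + u * y) / u))) \<partial>lborel)"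
    using assms by (subst nn_integral_real_affine[where c = u and t = 0]) auto
  also have "\<dots> = ennreal u * (\<integral>\<^sup>+ y. ennreal (u powr a) * ennreal (indicator {0..} y * y powr (a + 1 - 1) / exp y) \<partial>lborel)"
    using assms
    by (intro arg_cong2[where f = "(*)"] nn_integral_cong refl)
       (auto simp: indicator_def powr_mult zero_less_mult_iff exp_minus field_simps simp flip: ennreal_mult)
  also have "\<dots> = ennreal u * (ennreal (u powr a) * ennreal (Gamma (a + 1)))"
    using assms by (subst nn_integral_cmult) (simp_all add: Gamma_conv_nn_integral_real del: ennreal_mult'')
  also have "\<dots> = ennreal (u powr (a + 1) * Gamma (a + 1))"
    using assms by (simp add: powr_add mult_ac flip: ennreal_mult)
  finally show ?thesis .
qed

text \<open>
  With the half-line integral inserted, everything is nonnegative and Tonelli allows integrating over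
  \<open>x\<close> first: this yields \<open>Gamma (a + 1) * u powr (a + 1)\<close>, and the remaining integral over \<open>u\<close> is
  the Gamma integral at \<open>a + v + 1\<close>. Working with nonnegative integrals gives the integrability of
  the integrand at the same time.
\<close>
lemma nn_integral_bessel_K_moment:
  fixes a v :: real
  assumes a: "-1 < a" and av: "-1 < a + v"
  shows "(\<integral>\<^sup>+ x. ennreal (indicator {0<..} x * (x powr (a + v / 2) * bessel_K v (2 * sqrt x))) \<partial>lborel)
    = ennreal (Gamma (a + 1) * Gamma (a + v + 1) / 2)"
proof -
  have kernel: "ennreal (indicator {0<..} x * (x powr (a + v / 2) * bessel_K v (2 * sqrt x)))
    = (\<integral>\<^sup>+ u. ennreal (indicator {0<..} x * x powr a / 2 * (indicator {0<..} u *
         (u powr (v - 1) * exp (- (u + x / u))))) \<partial>lborel)" for x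
  proof (cases "0 < x")
    case True
    note int = integrable_bessel_kernel[OF True, of v, unfolded set_integrable_def]
    have "x powr (a + v / 2) * bessel_K v (2 * sqrt x)
      = x powr a / 2 * (LBINT u:{0<..}. u powr (v - 1) * exp (- (u + x / u)))"
      using bessel_K_eq_half_line_integral[OF True, of v] by (simp add: powr_add)
    also have "\<dots> = (LBINT u. x powr a / 2 * (indicator {0<..} u *
         (u powr (v - 1) * exp (- (u + x / u)))))"
      by (simp add: set_lebesgue_integral_def)
    finally have *: "x powr (a + v / 2) * bessel_K v (2 * sqrt x) = \<dots>" .
    show ?thesis
      using True int unfolding * by (subst nn_integral_eq_integral) auto
  qed simp
  have "(\<integral>\<^sup>+ x. ennreal (indicator {0<..} x * (x powr (a + v / 2) * bessel_K v (2 * sqrt x))) \<partial>lborel)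
    = (\<integral>\<^sup>+ u. \<integral>\<^sup>+ x. ennreal (indicator {0<..} x * x powr a / 2 * (indicator {0<..} u *
         (u powr (v - 1) * exp (- (u + x / u))))) \<partial>lborel \<partial>lborel)"
    unfolding kernel by (intro lborel_pair.Fubini') measurable
  also have "\<dots> = (\<integral>\<^sup>+ u. ennreal (Gamma (a + 1) / 2) *
      ennreal (indicator {0..} u * u powr (a + v + 1 - 1) / exp u) \<partial>lborel)"
  proof (intro nn_integral_cong)
    fix u :: real
    show "(\<integral>\<^sup>+ x. ennreal (indicator {0<..} x * x powr a / 2 * (indicator {0<..} u *
         (u powr (v - 1) * exp (- (u + x / u))))) \<partial>lborel)
      = ennreal (Gamma (a + 1) / 2) * ennreal (indicator {0..} u * u powr (a + v + 1 - 1) / exp u)"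
    proof (cases "0 < u")
      case True
      have exp_split: "exp (- (u + x / u)) = inverse (exp u) * exp (- (x / u))" for x
        by (simp only: minus_add_distrib exp_add exp_minus)
      have "(\<integral>\<^sup>+ x. ennreal (indicator {0<..} x * x powr a / 2 * (indicator {0<..} u *
         (u powr (v - 1) * exp (- (u + x / u))))) \<partial>lborel)
        = (\<integral>\<^sup>+ x. ennreal (u powr (v - 1) / (2 * exp u)) *
            ennreal (indicator {0<..} x * x powr a * exp (- (x / u))) \<partial>lborel)"
        using True unfolding exp_split
        by (intro nn_integral_cong) (simp add: field_simps flip: ennreal_mult)
      also have "\<dots> = ennreal (u powr (v - 1) / (2 * exp u)) * ennreal (u powr (a + 1) * Gamma (a + 1))"
        by (subst nn_integral_cmult) (simp_all add: nn_integral_powr_exp[OF a True])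
      also have "\<dots> = ennreal (u powr (v - 1) / (2 * exp u) * (u powr (a + 1) * Gamma (a + 1)))"
        using a by (subst ennreal_mult) auto
      also have "u powr (v - 1) / (2 * exp u) * (u powr (a + 1) * Gamma (a + 1))
        = Gamma (a + 1) / 2 * (u powr (a + v) / exp u)"
        using True by (simp add: powr_add powr_diff)
      finally show ?thesis
        using True a by (simp flip: ennreal_mult)
    next
      case False
      then show ?thesis by (cases "u = 0") auto
    qed
  qed
  also have "\<dots> = ennreal (Gamma (a + 1) / 2) * ennreal (Gamma (a + v + 1))"
    using av by (subst nn_integral_cmult) (simp_all only: Gamma_conv_nn_integral_real, simp_all)
  also have "\<dots> = ennreal (Gamma (a + 1) * Gamma (a + v + 1) / 2)"
    using a av by (subst ennreal_mult[symmetric]) auto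
  finally show ?thesis .
qed

lemma has_bochner_integral_bessel_K_moment:
  fixes a v :: real
  assumes a: "-1 < a" and av: "-1 < a + v"
  shows "has_bochner_integral lborel
    (\<lambda>x. indicator {0<..} x * (x powr (a + v / 2) * bessel_K v (2 * sqrt x)))
    (Gamma (a + 1) * Gamma (a + v + 1) / 2)"
  using assms
  by (intro has_bochner_integral_nn_integral nn_integral_bessel_K_moment)
     (auto intro!: AE_I2 simp: bessel_K_nonneg)

section \<open>Powers as combinations of rising factorials\<close>

text \<open>
  Up to a factor \<open>x\<close> this is the inversion
  \<open>x ^ (m + 1) = (\<Sum>i. (- 1) ^ (m + 1 - i) * S (m + 1, i) * pochhammer x i)\<close>, because
  \<open>pochhammer x (i + 1) = x * pochhammer (x + 1) i\<close>. Having divided by \<open>x\<close> matters since the value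
  at \<open>x = 0\<close>, the constant term of the power series, is needed as well.

  In the induction step the recurrence \<open>S (m + 2, i + 1) = (i + 1) * S (m + 1, i + 1) + S (m + 1, i)\<close>
  splits the sum. After a shift of the index in the second part, the two parts
  contribute the factors \<open>- (i + 1)\<close> and \<open>x + 1 + i\<close>, whose sum is \<open>x\<close>.
\<close>
lemma sum_Stirling_pochhammer:
  fixes x :: "'a :: comm_ring_1"
  shows "(\<Sum>j\<le>m. (-1) ^ j * of_nat (Stirling (m + 1) (m + 1 - j)) * pochhammer (x + 1) (m - j)) = x ^ m"
proof (induction m)
  case (Suc m)
  define S where "S i = (of_nat (Stirling (m + 1) i) :: 'a)" for i
  define p where "p i = pochhammer (x + 1) i" for i
  have rev: "(\<Sum>j\<le>n. (-1) ^ j * of_nat (Stirling (n + 1) (n + 1 - j)) * pochhammer (x + 1) (n - j))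
     = (\<Sum>i\<le>n. (-1) ^ (n - i) * of_nat (Stirling (n + 1) (Suc i)) * p i)" for n
    by (rule sum.reindex_bij_witness[of _ "\<lambda>i. n - i" "\<lambda>i. n - i"]) (auto simp: p_def Suc_diff_le)
  have IH: "(\<Sum>i\<le>m. (-1) ^ (m - i) * S (Suc i) * p i) = x ^ m"
    using Suc.IH rev[of m] by (simp add: S_def)
  have p_Suc: "p (Suc i) = p i * (x + 1 + of_nat i)" for i
    by (simp add: p_def pochhammer_Suc)
  have "(\<Sum>i\<le>Suc m. (-1) ^ (Suc m - i) * of_nat (Stirling (Suc m + 1) (Suc i)) * p i)
    = (\<Sum>i\<le>Suc m. (-1) ^ (Suc m - i) * (of_nat (Suc i) * S (Suc i)) * p i)
      + (\<Sum>i\<le>Suc m. (-1) ^ (Suc m - i) * S i * p i)"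
    by (simp add: S_def sum.distrib[symmetric] algebra_simps del: sum.atMost_Suc)
  also have "(\<Sum>i\<le>Suc m. (-1) ^ (Suc m - i) * (of_nat (Suc i) * S (Suc i)) * p i)
    = (\<Sum>i\<le>m. - ((-1) ^ (m - i) * S (Suc i) * p i * (of_nat i + 1)))"
    by (simp add: S_def Suc_diff_le algebra_simps sum_negf)
  also have "(\<Sum>i\<le>Suc m. (-1) ^ (Suc m - i) * S i * p i)
    = (\<Sum>i\<le>m. (-1) ^ (m - i) * S (Suc i) * p i * (x + 1 + of_nat i))"
    by (subst sum.atMost_Suc_shift) (simp add: S_def p_Suc mult.assoc)
  also have "(\<Sum>i\<le>m. - ((-1) ^ (m - i) * S (Suc i) * p i * (of_nat i + 1))) + \<dots>
    = (\<Sum>i\<le>m. (-1) ^ (m - i) * S (Suc i) * p i * x)"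
    unfolding sum.distrib[symmetric] by (intro sum.cong refl) (simp add: algebra_simps)
  also have "\<dots> = x ^ Suc m"
    by (simp add: IH sum_distrib_right[symmetric])
  finally show ?case
    unfolding rev .
qed simp

section \<open>Termwise integration of the hyperbolic sine\<close>

text \<open>
  The quotient of consecutive terms tends to \<open>r\<close>: the growth of \<open>(2 * k + 1)!\<close> over the two
  factorials in the numerator is \<open>4 ^ k\<close> up to a power of \<open>k\<close>. This is where the radius of
  convergence \<open>1\<close> comes from.
\<close>
lemma summable_factorial_ratio:
  fixes r :: real
  assumes "0 \<le> r" "r < 1"
  shows "summable (\<lambda>k. 4 ^ k * r ^ k * (fact (k + 1) * fact (n + k)) / fact (2 * k + 1))"
proof -
  define q where "q k = 4 * real (k + 2) * real (n + k + 1) / (real (2 * k + 2) * real (2 * k + 3))" for k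
  define c where "c = (1 + r) / 2"
  have "q \<longlonglongrightarrow> 1"
    unfolding q_def by real_asymp
  then have "(\<lambda>k. q k * r) \<longlonglongrightarrow> 1 * r"
    by (intro tendsto_intros)
  moreover have "1 * r < c" using assms by (simp add: c_def)
  ultimately have "eventually (\<lambda>k. q k * r < c) sequentially"
    by (rule order_tendstoD)
  then obtain K where K: "\<And>k. k \<ge> K \<Longrightarrow> q k * r < c"
    by (auto simp: eventually_sequentially)
  define t where "t k = 4 ^ k * r ^ k * (fact (k + 1) * fact (n + k)) / fact (2 * k + 1)" for k
  have t0: "0 \<le> t k" for k using assms by (simp add: t_def)
  have "summable t"
  proof (rule summable_ratio_test[of c K])
    show "c < 1" using assms by (simp add: c_def)
    fix k assume "K \<le> k"
    have "t (Suc k) = (q k * r) * t k"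
    proof -
      have f: "fact (2 * Suc k + 1) = real (2 * k + 3) * (real (2 * k + 2) * fact (2 * k + 1))"
        "fact (Suc k + 1) = real (k + 2) * fact (k + 1)"
        "fact (n + Suc k) = real (n + k + 1) * fact (n + k)"
        by (simp_all add: algebra_simps)
      show ?thesis
        unfolding t_def q_def f by (simp add: mult_ac del: fact_Suc of_nat_add of_nat_Suc of_nat_mult)
    qed
    also have "\<dots> \<le> c * t k"
      using K[OF \<open>K \<le> k\<close>] t0[of k] by (intro mult_right_mono) auto
    finally show "norm (t (Suc k)) \<le> c * norm (t k)"
      using t0[of k] t0[of "Suc k"] by simp
  qed
  then show ?thesis
    unfolding t_def[abs_def] .
qed

lemma sinh_sums_odd:
  fixes x :: "'a :: {banach, real_normed_field}"
  shows "(\<lambda>k. x ^ (2 * k + 1) / fact (2 * k + 1)) sums sinh x"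
proof -
  have "strict_mono (\<lambda>k::nat. 2 * k + 1)" by (simp add: strict_mono_def)
  moreover have "n \<in> range (\<lambda>k. 2 * k + 1)" if "odd n" for n :: nat
    using that by (auto elim: oddE)
  ultimately have "(\<lambda>k. if even (2 * k + 1) then 0 else x ^ (2 * k + 1) /\<^sub>R fact (2 * k + 1)) sums sinh x
      \<longleftrightarrow> (\<lambda>n. if even n then 0 else x ^ n /\<^sub>R fact n) sums sinh x"
    by (intro sums_mono_reindex) auto
  then show ?thesis
    using sinh_converges[of x]
    by (simp add: scaleR_conv_of_real field_simps del: fact_Suc)
qed

text \<open>
  Expanding \<open>sinh\<close> in powers of \<open>sqrt x\<close> makes every term a constant multiple of a moment with
  \<open>v = n - 1\<close> and \<open>a = k + 1\<close>, since \<open>n / 2 + (2 * k + 1) / 2 = (k + 1) + v / 2\<close>; the order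
  \<open>1 - n = - v\<close> of the Bessel function may be replaced by \<open>v\<close>. The moments are factorials. Sum and
  integral commute because the integrals of the absolute values form the same series for
  \<open>cmod w\<close> and \<open>cmod z\<close>, which converges.
\<close>
lemma bessel_K_sinh_integral:
  fixes n :: nat and z w :: complex
  assumes z: "cmod z < 1" and w: "w ^ 2 = z"
  defines "F \<equiv> (\<lambda>x. of_real (x powr (real n / 2) * bessel_K (1 - real n) (2 * sqrt x))
                  * sinh (2 * (of_real (sqrt x) * w)))"
  shows "set_integrable lborel {0<..} F"
    and "(\<lambda>k. w * (4 ^ k * z ^ k * (fact (k + 1) * fact (n + k)) / fact (2 * k + 1)))
      sums (LBINT x:{0<..}. F x)"
proof -
  define v where "v = real n - 1"
  define b where "b k x = indicator {0<..} x * (x powr (real (k + 1) + v / 2) * bessel_K v (2 * sqrt x))"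
    for k x
  define c where "c k = (2 * w) ^ (2 * k + 1) / fact (2 * k + 1)" for k
  define M :: "nat \<Rightarrow> real" where "M k = fact (k + 1) * fact (n + k) / 2" for k
  define f where "f k x = of_real (b k x) * c k" for k x
  have b: "has_bochner_integral lborel (b k) (M k)" for k
  proof -
    have "Gamma (real (k + 1) + 1) = fact (k + 1)"
      using Gamma_fact[of "k + 1", where 'a = real] by (simp add: add_ac)
    moreover have "Gamma (real (k + 1) + v + 1) = fact (n + k)"
      using Gamma_fact[of "n + k", where 'a = real] by (simp add: v_def add_ac)
    ultimately show ?thesis
      using has_bochner_integral_bessel_K_moment[of "real (k + 1)" v]
      by (simp add: b_def[abs_def] M_def v_def)
  qed
  have M0: "0 \<le> M k" for k
    by (simp add: M_def)
  have b0: "0 \<le> b k x" for k x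
    by (simp add: b_def bessel_K_nonneg)
  have f: "has_bochner_integral lborel (f k) (of_real (M k) * c k)" for k
    unfolding f_def by (intro has_bochner_integral_mult_left has_bochner_integral_of_real b)
  have nf: "norm (f k x) = b k x * norm (c k)" for k x
    using b0[of k x] by (simp add: f_def norm_mult)
  have inf: "(LBINT x. norm (f k x)) = M k * norm (c k)" for k
    unfolding nf using has_bochner_integral_mult_left[OF b[of k], of "norm (c k)"]
    by (simp add: has_bochner_integral_iff)
  have Mc: "of_real (M k) * c k = w * (4 ^ k * z ^ k * (fact (k + 1) * fact (n + k)) / fact (2 * k + 1))" for k
  proof -
    have "(2 * w) ^ (2 * k + 1) = 2 * w * (4 ^ k * z ^ k)"
      by (simp add: power_mult power_mult_distrib flip: w)
    then show ?thesis
      unfolding M_def c_def by (simp add: mult_ac del: fact_Suc)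
  qed
  have norm_Mc: "M k * norm (c k)
    = cmod w * (4 ^ k * cmod z ^ k * (fact (k + 1) * fact (n + k)) / fact (2 * k + 1))" for k
  proof -
    have "M k * norm (c k) = norm (of_real (M k) * c k)"
      by (simp only: norm_mult norm_of_real abs_of_nonneg M0)
    then show ?thesis
      unfolding Mc by (simp add: norm_mult norm_divide norm_power del: fact_Suc)
  qed
  have expansion: "f k x = indicator {0<..} x *\<^sub>R (of_real (x powr (real n / 2) * bessel_K (1 - real n) (2 * sqrt x))
       * ((2 * (of_real (sqrt x) * w)) ^ (2 * k + 1) / fact (2 * k + 1)))" for k x
  proof (cases "0 < x")
    case True
    have "x powr (real (k + 1) + v / 2) = x powr (real n / 2 + (1 / 2) * real (2 * k + 1))"
      by (simp add: v_def field_simps)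
    also have "\<dots> = x powr (real n / 2) * sqrt x ^ (2 * k + 1)"
      using True by (simp only: powr_add powr_powr[symmetric] powr_half_sqrt less_imp_le powr_realpow real_sqrt_gt_zero)
    finally have p: "x powr (real (k + 1) + v / 2) = x powr (real n / 2) * sqrt x ^ (2 * k + 1)" .
    have K: "bessel_K v (2 * sqrt x) = bessel_K (1 - real n) (2 * sqrt x)"
      using bessel_K_minus[of v] by (simp add: v_def)
    show ?thesis
      using True unfolding f_def b_def c_def p K
      by (simp add: power_mult_distrib del: fact_Suc power_Suc)
  qed (simp add: f_def b_def)
  have fsums: "(\<lambda>k. f k x) sums (indicator {0<..} x *\<^sub>R F x)" for x
    unfolding expansion F_def by (intro sums_scaleR_right sums_mult sinh_sums_odd)
  have sn: "summable (\<lambda>k. norm (f k x))" for x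
  proof -
    have "summable (\<lambda>k. (2 * norm (of_real (sqrt x) * w)) ^ (2 * k + 1) / fact (2 * k + 1))"
      using sinh_sums_odd[of "2 * norm (of_real (sqrt x) * w)"] by (simp add: sums_iff)
    then have "summable (\<lambda>k. norm (indicator {0<..} x * (x powr (real n / 2) * bessel_K (1 - real n) (2 * sqrt x)))
      * ((2 * norm (of_real (sqrt x) * w)) ^ (2 * k + 1) / fact (2 * k + 1)))"
      by (rule summable_mult)
    moreover have "norm (f k x) = norm (indicator {0<..} x * (x powr (real n / 2) * bessel_K (1 - real n) (2 * sqrt x)))
      * ((2 * norm (of_real (sqrt x) * w)) ^ (2 * k + 1) / fact (2 * k + 1))" for k
      unfolding expansion
      by (simp add: norm_mult norm_divide norm_power abs_mult del: fact_Suc power_Suc)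
    ultimately show ?thesis by simp
  qed
  have si: "summable (\<lambda>k. LBINT x. norm (f k x))"
    unfolding inf norm_Mc by (intro summable_mult summable_factorial_ratio z) auto
  have fi: "integrable lborel (f k)" for k
    using f by (simp add: has_bochner_integral_iff)
  have lim: "(\<lambda>x. \<Sum>k. f k x) = (\<lambda>x. indicator {0<..} x *\<^sub>R F x)"
    using fsums by (simp add: sums_iff)
  have "integrable lborel (\<lambda>x. \<Sum>k. f k x)"
    by (rule integrable_suminf[OF fi _ si]) (use sn in auto)
  then show "set_integrable lborel {0<..} F"
    unfolding lim set_integrable_def .
  have "(\<lambda>k. LBINT x. f k x) sums (LBINT x. \<Sum>k. f k x)"
    by (rule sums_integral[OF fi _ si]) (use sn in auto)
  then show "(\<lambda>k. w * (4 ^ k * z ^ k * (fact (k + 1) * fact (n + k)) / fact (2 * k + 1)))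
      sums (LBINT x:{0<..}. F x)"
    unfolding lim set_lebesgue_integral_def using f Mc by (simp add: has_bochner_integral_iff)
qed

section \<open>The generating function\<close>

lemma g_term_eq_factorials:
  "g_term m z k = 4 ^ k * z ^ k * (fact (k + 1) * fact k) / fact (2 * k + 1) * of_nat k ^ m"
proof -
  have "of_nat ((2 * k) choose k) = (fact (2 * k) / (fact k * fact k) :: complex)"
    using binomial_fact[of k "2 * k", where 'a = complex] by (simp add: mult_2)
  then have "of_real (catalan k) = (fact (2 * k) / (fact k * fact k) / (of_nat k + 1) :: complex)"
    by (simp add: catalan_def add.commute)
  moreover have "fact (k + 1) = ((of_nat k + 1) * fact k :: complex)"
    "fact (2 * k + 1) = ((2 * of_nat k + 1) * fact (2 * k) :: complex)"
    by (simp_all add: add.commute)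
  moreover have "2 ^ (2 * k) = (4 ^ k :: complex)"
    by (simp add: power_mult)
  ultimately show ?thesis
    by (simp only: g_term_def) (simp add: mult_ac)
qed

theorem theorem8:
  fixes m :: nat and z w :: complex
  assumes "0 < cmod z" and "cmod z < 1"
    and "w ^ 2 = z"
  shows "summable (g_term m z) \<and>
         (\<forall>j\<in>{0..m}. set_integrable lborel {0<..} (\<lambda>x::real.
           of_real (x powr ((real m - real j) / 2) * bessel_K (real j + 1 - real m) (2 * sqrt x))
             * sinh (2 * (of_real (sqrt x) * w)))) \<and>
         g m z = 1 / w * (\<Sum>j=0..m. (-1) ^ j * of_nat (Stirling (m + 1) (m + 1 - j))
           * (LBINT x:{0<..}.
                of_real (x powr ((real m - real j) / 2) * bessel_K (real j + 1 - real m) (2 * sqrt x))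
                  * sinh (2 * (of_real (sqrt x) * w))))"
proof -
  define F where "F j x = of_real (x powr ((real m - real j) / 2) * bessel_K (real j + 1 - real m) (2 * sqrt x))
             * sinh (2 * (of_real (sqrt x) * w))" for j x
  define s where "s j = ((-1) ^ j * of_nat (Stirling (m + 1) (m + 1 - j)) :: complex)" for j
  define t where "t j k = 4 ^ k * z ^ k * (fact (k + 1) * fact (m - j + k)) / fact (2 * k + 1)" for j k
  have w0: "w \<noteq> 0" using assms by auto
  have F: "F j = (\<lambda>x. of_real (x powr (real (m - j) / 2) * bessel_K (1 - real (m - j)) (2 * sqrt x))
                  * sinh (2 * (of_real (sqrt x) * w)))" if "j \<le> m" for j
    using that by (simp add: F_def fun_eq_iff of_nat_diff algebra_simps)
  have integrable: "set_integrable lborel {0<..} (F j)" if "j \<le> m" for j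
    unfolding F[OF that] using assms(2,3) by (rule bessel_K_sinh_integral)
  have "(\<lambda>k. w * t j k) sums (LBINT x:{0<..}. F j x)" if "j \<le> m" for j
    unfolding F[OF that] t_def using assms(2,3) by (rule bessel_K_sinh_integral)
  then have "(\<lambda>k. 1 / w * (\<Sum>j=0..m. s j * (w * t j k)))
      sums (1 / w * (\<Sum>j=0..m. s j * (LBINT x:{0<..}. F j x)))"
    by (intro sums_mult sums_sum) auto
  moreover have "1 / w * (\<Sum>j=0..m. s j * (w * t j k)) = g_term m z k" for k
  proof -
    \<comment> \<open>Pulling out \<open>k!\<close> leaves the rising factorials of \<open>k + 1\<close> of length \<open>m - j\<close>, which the
      Stirling numbers combine into \<open>k ^ m\<close>.\<close>
    have fact_shift: "fact (m - j + k) = fact k * (pochhammer (of_nat k + 1) (m - j) :: complex)" for j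
      using pochhammer_product[of k "m - j + k" "1 :: complex"]
      by (simp add: pochhammer_fact add.commute)
    have "1 / w * (\<Sum>j=0..m. s j * (w * t j k)) = (\<Sum>j\<le>m. s j * t j k)"
      using w0 by (simp add: sum_distrib_left mult_ac atMost_atLeast0)
    also have "\<dots> = 4 ^ k * z ^ k * (fact (k + 1) * fact k) / fact (2 * k + 1)
        * (\<Sum>j\<le>m. s j * pochhammer (of_nat k + 1) (m - j))"
      unfolding t_def fact_shift sum_distrib_left by (simp add: mult_ac del: fact_Suc)
    also have "\<dots> = g_term m z k"
      unfolding s_def sum_Stirling_pochhammer g_term_eq_factorials ..
    finally show ?thesis .
  qed
  ultimately have "g_term m z sums (1 / w * (\<Sum>j=0..m. s j * (LBINT x:{0<..}. F j x)))"
    by simp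
  then have "summable (g_term m z)" "g m z = 1 / w * (\<Sum>j=0..m. s j * (LBINT x:{0<..}. F j x))"
    by (auto simp: g_def sums_iff)
  with integrable show ?thesis
    unfolding F_def s_def by simp
qed

end
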